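(* Let $\{Z_n\}_{n\ge 0}$ be a branching random walk on $\mathbb{R}$ with offspring law $\{p_k\}_{k\ge0}$ and step size $X$, satisfying: $p_0=0$, $1<m<\infty$, $\mathbb{E}[X]=0$, $\mathbb{P}(X=0)<1$, and $\mathbb{E}[e^{\kappa X}]<\infty$ for some $\kappa>0$. Let $\mu:=\sup\{k\ge1: p_k>0\}\in(0,\infty]$. Assume $\mathbb{E}[e^{\theta |Z_1|}]<\infty$ for some $\theta>0$. Suppose $p_k<1$ for any $k\ge2$, $x\in(0,L)$ and $a\in[\log m,\log\mu]\cap\mathbb{R}$, and let $\alpha:=\inf\{k: p_k>0,\ k\ge e^a\}$. Then $$a-\log m\leq\liminf_{n\to\infty}\frac{1}{n}\log\left[-\log\mathbb{P}(Z_n([xn,\infty))\geq e^{an})\right]\leq\limsup_{n\to\infty}\frac{1}{n}\log\left[-\log\mathbb{P}(Z_n([xn,\infty))\geq e^{an})\right]\leq\log\alpha.$$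
   Context: Branching random walk: at time $0$ there is one particle at the origin ($Z_0=\delta_0$). At each time step every particle dies and produces a random number of offspring according to $\{p_k\}_{k\ge0}$, after which each offspring moves from its parent's position by an independent displacement distributed as $X$; the branching and the motion are independent, and different particles behave independently. $Z_n$ is the point process (counting measure) of positions of the particles at generation $n$; $Z_n(A)$ is the number of generation-$n$ particles located in $A\subset\mathbb{R}$; $|Z_n|:=Z_n(\mathbb{R})$; $m:=\mathbb{E}[|Z_1|]=\sum_k kp_k$. Notation: $L:=\sup\{x\in\mathbb{R}:\mathbb{P}(X>x)>0\}\in(-\infty,\infty]$ is the essential supremum of $X$; $\log\infty:=\infty$. *)

theory Defs
  imports "HOL-Probability.Probability"
begin

text \<open>
  Logarithm on the extended reals, with \<open>log 0 = -\<infinity>\<close> and \<open>log \<infinity> = \<infinity>\<close>. The value on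
  negative arguments is immaterial.
\<close>

definition ext_ln :: "ereal \<Rightarrow> ereal" where
  "ext_ln y = (if y = \<infinity> then \<infinity> else if y \<le> 0 then -\<infinity> else ereal (ln (real_of_ereal y)))"

lemma ext_ln_simps [simp]:
  "ext_ln \<infinity> = \<infinity>"
  "ext_ln 0 = -\<infinity>"
  "0 < r \<Longrightarrow> ext_ln (ereal r) = ereal (ln r)"
  by (auto simp: ext_ln_def)

text \<open>
  Potential particles carry Ulam--Harris labels: the root is \<open>[]\<close> and the \<open>i\<close>-th child of \<open>u\<close>
  (counting from \<open>0\<close>) is \<open>u @ [i]\<close>. \<open>N u\<close> is the number of offspring of \<open>u\<close> and \<open>Y u\<close> is the
  displacement of \<open>u\<close> from the position of its parent; \<open>Y []\<close> is never used, as the initial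
  particle sits at the origin.

  A pair \<open>(N u, Y u)\<close> has the product law of offspring and step, and these pairs are independent
  over \<open>u\<close>; hence all the \<open>N u\<close> and \<open>Y v\<close> together form one independent family. Marks are
  attached to every label, but only those of labels realised in the tree enter the process.
\<close>

locale branching_random_walk =
  prob_space M + step: real_distribution \<nu>
  for M :: "'w measure" and p :: "nat pmf" and \<nu> :: "real measure"
    and N :: "nat list \<Rightarrow> 'w \<Rightarrow> nat" and Y :: "nat list \<Rightarrow> 'w \<Rightarrow> real" +
  assumes indep_marks:
      "indep_vars (\<lambda>_. measure_pmf p \<Otimes>\<^sub>M \<nu>) (\<lambda>u \<omega>. (N u \<omega>, Y u \<omega>)) UNIV"
    and law_marks:
      "distr M (measure_pmf p \<Otimes>\<^sub>M \<nu>) (\<lambda>\<omega>. (N u \<omega>, Y u \<omega>)) = measure_pmf p \<Otimes>\<^sub>M \<nu>"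

definition generation :: "(nat list \<Rightarrow> 'w \<Rightarrow> nat) \<Rightarrow> nat \<Rightarrow> 'w \<Rightarrow> nat list set" where
  "generation N n \<omega> = {u. length u = n \<and> (\<forall>i<n. u ! i < N (take i u) \<omega>)}"

definition position :: "(nat list \<Rightarrow> 'w \<Rightarrow> real) \<Rightarrow> nat list \<Rightarrow> 'w \<Rightarrow> real" where
  "position Y u \<omega> = (\<Sum>i=1..length u. Y (take i u) \<omega>)"

text \<open>\<open>brw_count N Y n A\<close> is the number of particles of generation \<open>n\<close> located in \<open>A\<close>.\<close>

definition brw_count ::
    "(nat list \<Rightarrow> 'w \<Rightarrow> nat) \<Rightarrow> (nat list \<Rightarrow> 'w \<Rightarrow> real) \<Rightarrow> nat \<Rightarrow> real set \<Rightarrow> 'w \<Rightarrow> nat" where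
  "brw_count N Y n A \<omega> = card {u \<in> generation N n \<omega>. position Y u \<omega> \<in> A}"

lemma generation_0: "generation N 0 \<omega> = {[]}"
  by (auto simp: generation_def)

lemma generation_Suc:
  "generation N (Suc n) \<omega> = (\<Union>u\<in>generation N n \<omega>. (\<lambda>i. u @ [i]) ` {..<N u \<omega>})"
proof (intro set_eqI iffI)
  fix v assume v: "v \<in> generation N (Suc n) \<omega>"
  then have len: "length v = Suc n" and lt: "\<And>i. i < Suc n \<Longrightarrow> v ! i < N (take i v) \<omega>"
    by (auto simp: generation_def)
  obtain u i where ui: "v = u @ [i]" "length u = n"
    using len by (metis length_Suc_conv_rev)
  have "u ! j < N (take j u) \<omega>" if "j < n" for j
    using lt[of j] ui that by (simp add: nth_append)
  moreover have "i < N u \<omega>"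
    using lt[of n] ui(1) unfolding ui(2)[symmetric] by simp
  ultimately show "v \<in> (\<Union>u\<in>generation N n \<omega>. (\<lambda>i. u @ [i]) ` {..<N u \<omega>})"
    using ui by (auto simp: generation_def)
next
  fix v assume "v \<in> (\<Union>u\<in>generation N n \<omega>. (\<lambda>i. u @ [i]) ` {..<N u \<omega>})"
  then show "v \<in> generation N (Suc n) \<omega>"
    by (auto simp: generation_def nth_append less_Suc_eq)
qed

lemma finite_generation: "finite (generation N n \<omega>)"
  by (induction n) (auto simp: generation_0 generation_Suc)

lemma position_Nil: "position Y [] \<omega> = 0"
  by (simp add: position_def)

lemma position_snoc: "position Y (u @ [i]) \<omega> = position Y u \<omega> + Y (u @ [i]) \<omega>"
  by (simp add: position_def)

definition ess_sup :: "real measure \<Rightarrow> ereal" where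
  "ess_sup \<nu> = Sup {ereal x | x. measure \<nu> {x<..} > 0}"

definition max_offspring :: "nat pmf \<Rightarrow> ereal" where
  "max_offspring p = Sup {ereal (real k) | k. 1 \<le> k \<and> pmf p k > 0}"

text \<open>
  An infimum of natural numbers; the set is nonempty whenever \<open>exp a\<close> is at most
  \<open>max_offspring p\<close> (an infinite supremum means unbounded support, a finite one is attained).
\<close>

definition min_offspring_above :: "nat pmf \<Rightarrow> real \<Rightarrow> nat" where
  "min_offspring_above p a = Inf {k. pmf p k > 0 \<and> real k \<ge> exp a}"

end

theory Submission
  imports Defs "HOL-Real_Asymp.Real_Asymp"
begin

text \<open>
  Write \<open>P n\<close> for the probability that at least \<open>exp (a * n)\<close> particles of generation \<open>n\<close> lie to the
  right of \<open>x * n\<close>. On the double logarithmic scale constants do not matter, so each bound only has to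
  get the exponential growth rate of \<open>- ln (P n)\<close> right.

  For the upper bound let \<open>\<alpha>\<close> be the least possible offspring number that is at least \<open>exp a\<close>. If every
  particle in the first \<open>n\<close> generations has exactly \<open>\<alpha>\<close> children and every step is at least \<open>x\<close>, then
  generation \<open>n\<close> consists of \<open>\<alpha> ^ n \<ge> exp (a * n)\<close> particles, all to the right of \<open>x * n\<close>. This
  prescribes the marks of at most \<open>(n + 1) * \<alpha> ^ n\<close> labels, each with the same positive probability
  because \<open>x\<close> is below the essential supremum of the step (\<open>prob_full_tree_ge\<close>). Hence
  \<open>- ln (P n)\<close> grows at most like \<open>\<alpha> ^ n\<close>, up to a factor that is linear in \<open>n\<close>.

  For the lower bound with \<open>a > ln m\<close> the positions are dropped and only the population size is
  controlled. Since the offspring law has exponential moments, for every \<open>c > m\<close> its moment generating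
  function is at most \<open>exp (c * t)\<close> for small \<open>t > 0\<close> (\<open>mgf_le_exp_near_zero\<close>). Iterating this over the
  generations shows that the generation size has a bounded exponential moment with parameter
  \<open>t0 / c ^ n\<close> (\<open>mgf_generation_bound\<close>). Markov's inequality gives
  \<open>P n \<le> exp (t0 - t0 * (exp a / c) ^ n)\<close>, so the rate is at least \<open>a - ln c\<close>, and \<open>c\<close> may approach
  \<open>m\<close>.

  In the boundary case \<open>a = ln m\<close> this argument is void, and it has to be shown that \<open>P n\<close> does not
  approach \<open>1\<close> too fast. Here the positions matter: the expected number of particles to the right of
  \<open>x * n\<close> is \<open>m ^ n\<close> times the probability that a centred random walk exceeds \<open>x * n\<close>, which decays
  exponentially because \<open>x > 0\<close>. The exponential form of this first moment computation is
  \<open>many_to_one_exp\<close>; Markov's inequality yields \<open>P n \<le> exp (- \<epsilon> * n)\<close> with \<open>\<epsilon> > 0\<close>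
  (\<open>prob_brw_count_le_many_to_one\<close>), so the rate is at least \<open>0\<close>.
\<close>

section \<open>Moment generating functions near zero\<close>

text \<open>
  The function \<open>t \<mapsto> exp (t * y)\<close> is convex, so the slope of its chord from \<open>0\<close> to \<open>t\<close> increases with \<open>t\<close>.
\<close>

lemma exp_difference_quotient_mono:
  fixes s t y :: real
  assumes "0 < t" "t \<le> s"
  shows "(exp (t * y) - 1) / t \<le> (exp (s * y) - 1) / s"
proof -
  have "exp ((1 - t / s) *\<^sub>R 0 + (t / s) *\<^sub>R (s * y)) \<le> (1 - t / s) * exp 0 + (t / s) * exp (s * y)"
    using assms by (intro convex_onD[OF exp_convex]) auto
  then have "exp (t * y) - 1 \<le> (t / s) * (exp (s * y) - 1)"
    using assms by (simp add: right_diff_distrib)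
  then show ?thesis
    using assms by (simp add: divide_le_eq mult.commute)
qed

text \<open>
  The right derivative at \<open>0\<close> of the moment generating function is the mean, hence smaller than \<open>c\<close>.
  The difference quotients are monotone in \<open>t\<close>. They therefore lie between \<open>X\<close> and the quotient at
  \<open>\<kappa>\<close>, which is the domination needed to pass to the limit under the expectation; and as soon as the
  expected quotient is below \<open>c\<close> at one point, it is so at all smaller points.
\<close>

lemma (in prob_space) mgf_le_exp_near_zero:
  fixes X :: "'a \<Rightarrow> real"
  assumes X: "integrable M X" and \<kappa>: "0 < \<kappa>" and eX: "integrable M (\<lambda>\<omega>. exp (\<kappa> * X \<omega>))"
    and c: "expectation X < c"
  obtains t0 where "0 < t0"
    "\<And>t. 0 < t \<Longrightarrow> t \<le> t0 \<Longrightarrow> (\<integral>\<^sup>+\<omega>. ennreal (exp (t * X \<omega>)) \<partial>M) \<le> ennreal (exp (c * t))"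
proof -
  have [measurable]: "X \<in> borel_measurable M"
    using X by simp
  define q where "q t \<omega> = (exp (t * X \<omega>) - 1) / t" for t \<omega>
  define s where "s k = \<kappa> / (real k + 1)" for k
  have s: "0 < s k" "s k \<le> \<kappa>" for k
    using \<kappa> by (auto simp: s_def field_simps)
  have lower: "X \<omega> \<le> q t \<omega>" if "0 < t" for t \<omega>
    using exp_ge_add_one_self[of "t * X \<omega>"] that by (simp add: q_def field_simps)
  have [measurable]: "q t \<in> borel_measurable M" for t
    unfolding q_def[abs_def] by measurable
  have int_q: "integrable M (q \<kappa>)"
    unfolding q_def using eX by auto
  have dom: "\<bar>q t \<omega>\<bar> \<le> \<bar>X \<omega>\<bar> + \<bar>q \<kappa> \<omega>\<bar>" if "0 < t" "t \<le> \<kappa>" for t \<omega>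
    using lower[OF that(1), of \<omega>] exp_difference_quotient_mono[OF that, of "X \<omega>"]
    unfolding q_def by linarith
  have lim: "(\<lambda>k. q (s k) \<omega>) \<longlonglongrightarrow> X \<omega>" for \<omega>
  proof -
    have "((\<lambda>t. exp (t * X \<omega>)) has_real_derivative X \<omega>) (at 0)"
      by (auto intro!: derivative_eq_intros)
    then have "((\<lambda>t. q t \<omega>) \<longlongrightarrow> X \<omega>) (at 0)"
      by (simp add: DERIV_def q_def)
    moreover have "filterlim s (at 0) sequentially"
    proof (rule filterlim_atI)
      show "s \<longlonglongrightarrow> 0"
        unfolding s_def using \<kappa> by real_asymp
      show "\<forall>\<^sub>F k in sequentially. s k \<noteq> 0"
        using s(1) by (intro always_eventually allI) (metis less_irrefl)
    qed
    ultimately show ?thesis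
      by (rule filterlim_compose)
  qed
  have "(\<lambda>k. expectation (q (s k))) \<longlonglongrightarrow> expectation X"
  proof (rule integral_dominated_convergence)
    show "integrable M (\<lambda>\<omega>. \<bar>X \<omega>\<bar> + \<bar>q \<kappa> \<omega>\<bar>)"
      using X int_q by auto
    show "AE \<omega> in M. (\<lambda>k. q (s k) \<omega>) \<longlonglongrightarrow> X \<omega>"
      using lim by auto
    show "AE \<omega> in M. norm (q (s k) \<omega>) \<le> \<bar>X \<omega>\<bar> + \<bar>q \<kappa> \<omega>\<bar>" for k
      using dom[OF s] by auto
  qed auto
  then have "\<forall>\<^sub>F k in sequentially. expectation (q (s k)) < c"
    using c by (rule order_tendstoD)
  then obtain k where k: "expectation (q (s k)) < c"
    by (auto simp: eventually_sequentially)
  show ?thesis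
  proof (rule that[of "s k"])
    fix t assume t: "0 < t" "t \<le> s k"
    have int: "integrable M (q t)" if "0 < t" "t \<le> \<kappa>" for t
      by (rule Bochner_Integration.integrable_bound[of M "\<lambda>\<omega>. \<bar>X \<omega>\<bar> + \<bar>q \<kappa> \<omega>\<bar>"])
         (use X int_q dom[OF that] in auto)
    have int_t: "integrable M (q t)"
      using t s(2)[of k] by (intro int) auto
    have eq: "exp (t * X \<omega>) = 1 + t * q t \<omega>" for \<omega>
      using t by (simp add: q_def)
    have int_e: "integrable M (\<lambda>\<omega>. exp (t * X \<omega>))"
      unfolding eq using int_t by auto
    have "expectation (q t) \<le> expectation (q (s k))"
      using exp_difference_quotient_mono[OF t] int[OF s] int_t
      by (intro integral_mono) (auto simp: q_def)
    then have "expectation (q t) \<le> c"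
      using k by simp
    have "expectation (\<lambda>\<omega>. exp (t * X \<omega>)) = 1 + t * expectation (q t)"
      unfolding eq using int_t by (simp add: prob_space)
    also have "\<dots> \<le> 1 + c * t"
      using mult_left_mono[OF \<open>expectation (q t) \<le> c\<close>, of t] t by (simp add: mult.commute)
    also have "\<dots> \<le> exp (c * t)"
      using exp_ge_add_one_self by auto
    finally show "(\<integral>\<^sup>+\<omega>. ennreal (exp (t * X \<omega>)) \<partial>M) \<le> ennreal (exp (c * t))"
      by (subst nn_integral_eq_integral[OF int_e]) (auto intro: ennreal_leI)
  qed (use s in auto)
qed

section \<open>Finite random sets\<close>

text \<open>
  A countable type has only countably many finite subsets, so a finite random set is a discrete random
  variable: arbitrary functions of it are measurable, and one can condition on its value.
\<close>

lemma measurable_finite_random_set: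
  fixes S :: "'a \<Rightarrow> 'b::countable set"
  assumes [measurable]: "\<And>u. Measurable.pred M (\<lambda>\<omega>. u \<in> S \<omega>)"
    and fin: "\<And>\<omega>. \<omega> \<in> space M \<Longrightarrow> finite (S \<omega>)"
  shows "S \<in> M \<rightarrow>\<^sub>M count_space {A. finite A}"
proof -
  have "S -` {A} \<inter> space M \<in> sets M" for A
  proof -
    have "{\<omega> \<in> space M. \<forall>u. u \<in> S \<omega> \<longleftrightarrow> u \<in> A} \<in> sets M"
      by measurable
    also have "{\<omega> \<in> space M. \<forall>u. u \<in> S \<omega> \<longleftrightarrow> u \<in> A} = S -` {A} \<inter> space M"
      by auto
    finally show ?thesis .
  qed
  then show ?thesis
    using fin by (simp add: measurable_count_space_eq_countable[OF countable_Collect_finite])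
qed

lemma nn_integral_split_finite_random_set:
  fixes S :: "'a \<Rightarrow> 'b::countable set" and F :: "'b set \<Rightarrow> 'a \<Rightarrow> ennreal"
  assumes S: "S \<in> M \<rightarrow>\<^sub>M count_space {A. finite A}" and F: "\<And>A. F A \<in> borel_measurable M"
  shows "(\<integral>\<^sup>+\<omega>. F (S \<omega>) \<omega> \<partial>M) =
    (\<integral>\<^sup>+A. (\<integral>\<^sup>+\<omega>. indicator {A} (S \<omega>) * F A \<omega> \<partial>M) \<partial>count_space {A. finite A})"
proof -
  have "F (S \<omega>) \<omega> = (\<integral>\<^sup>+A. indicator {A} (S \<omega>) * F A \<omega> \<partial>count_space {A. finite A})"
    if "\<omega> \<in> space M" for \<omega>
  proof -
    have fin: "finite (S \<omega>)"
      using measurable_space[OF S that] by auto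
    have "(\<integral>\<^sup>+A. indicator {A} (S \<omega>) * F A \<omega> \<partial>count_space {A. finite A})
        = (\<integral>\<^sup>+A. F A \<omega> * indicator {S \<omega>} A \<partial>count_space {A. finite A})"
      by (intro nn_integral_cong) (auto split: split_indicator)
    also have "\<dots> = F (S \<omega>) \<omega> * emeasure (count_space {A. finite A}) {S \<omega>}"
      using fin by (intro nn_integral_indicator_singleton) auto
    finally show ?thesis
      using fin by (simp add: emeasure_count_space_finite)
  qed
  then have "(\<integral>\<^sup>+\<omega>. F (S \<omega>) \<omega> \<partial>M)
      = (\<integral>\<^sup>+\<omega>. (\<integral>\<^sup>+A. indicator {A} (S \<omega>) * F A \<omega> \<partial>count_space {A. finite A}) \<partial>M)"
    by (intro nn_integral_cong)
  also have "\<dots> = (\<integral>\<^sup>+A. (\<integral>\<^sup>+\<omega>. indicator {A} (S \<omega>) * F A \<omega> \<partial>M) \<partial>count_space {A. finite A})"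
  proof (intro nn_integral_count_space_nn_integral countable_Collect_finite borel_measurable_times_ennreal F)
    show "(\<lambda>\<omega>. indicator {A} (S \<omega>) :: ennreal) \<in> borel_measurable M" for A
      by (rule measurable_compose[OF S]) simp
  qed
  finally show ?thesis .
qed

section \<open>Sums of products over words\<close>

lemma nn_integral_lists_prod:
  fixes q :: "'b::countable \<Rightarrow> ennreal"
  shows "(\<integral>\<^sup>+u. (\<Prod>i<n. q (u ! i)) \<partial>count_space {u. length u = n}) = (\<integral>\<^sup>+j. q j \<partial>count_space UNIV) ^ n"
proof (induction n)
  case 0
  have "{u :: 'b list. length u = 0} = {[]}" by auto
  then show ?case by (simp add: nn_integral_count_space_finite)
next
  case (Suc n)
  let ?L = "{u :: 'b list. length u = n}"
  interpret L: sigma_finite_measure "count_space ?L"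
    by (rule sigma_finite_measure_count_space_countable) simp
  have bij: "bij_betw (\<lambda>(j, u). j # u) (UNIV \<times> ?L) {u. length u = Suc n}"
    by (auto simp: bij_betw_def inj_on_def length_Suc_conv image_def)
  have "(\<integral>\<^sup>+u. (\<Prod>i<Suc n. q (u ! i)) \<partial>count_space {u. length u = Suc n})
      = (\<integral>\<^sup>+z. (\<Prod>i<Suc n. q ((case z of (j, u) \<Rightarrow> j # u) ! i)) \<partial>count_space (UNIV \<times> ?L))"
    by (rule nn_integral_bij_count_space[OF bij, symmetric])
  also have "\<dots> = (\<integral>\<^sup>+z. q (fst z) * (\<Prod>i<n. q (snd z ! i)) \<partial>count_space (UNIV \<times> ?L))"
    by (intro nn_integral_cong) (auto simp: prod.lessThan_Suc_shift simp del: prod.lessThan_Suc)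
  also have "count_space (UNIV \<times> ?L) = count_space (UNIV :: 'b set) \<Otimes>\<^sub>M count_space ?L"
    by (rule pair_measure_countable[symmetric]) (rule countableI_type)+
  also have "(\<integral>\<^sup>+z. q (fst z) * (\<Prod>i<n. q (snd z ! i)) \<partial>(count_space UNIV \<Otimes>\<^sub>M count_space ?L))
      = (\<integral>\<^sup>+j. (\<integral>\<^sup>+u. q j * (\<Prod>i<n. q (u ! i)) \<partial>count_space ?L) \<partial>count_space UNIV)"
    by (subst L.nn_integral_fst[symmetric]) (simp_all add: pair_measure_countable[OF countableI_type countableI_type])
  finally show ?case
    by (simp add: nn_integral_cmult nn_integral_multc Suc.IH)
qed

section \<open>Marks, generations and measurability\<close>

lemma generation_cong:
  assumes "\<And>v. length v < n \<Longrightarrow> N v \<omega> = N' v \<omega>'"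
  shows "generation N n \<omega> = generation N' n \<omega>'"
  unfolding generation_def using assms by (auto simp: less_le_trans)

context branching_random_walk
begin

lemma measurable_mark: "(\<lambda>\<omega>. (N u \<omega>, Y u \<omega>)) \<in> M \<rightarrow>\<^sub>M measure_pmf p \<Otimes>\<^sub>M \<nu>"
  using indep_marks by (auto simp: indep_vars_def)

lemma measurable_offspring [measurable]: "N u \<in> M \<rightarrow>\<^sub>M count_space UNIV"
proof -
  have "N u \<in> M \<rightarrow>\<^sub>M measure_pmf p"
    using measurable_compose[OF measurable_mark measurable_fst] by simp
  then show ?thesis by simp
qed

lemma measurable_step [measurable]: "Y u \<in> borel_measurable M"
proof -
  have "Y u \<in> M \<rightarrow>\<^sub>M \<nu>"
    using measurable_compose[OF measurable_mark measurable_snd] by simp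
  then show ?thesis
    by (simp cong: measurable_cong_sets)
qed

lemma measurable_position [measurable]: "position Y u \<in> borel_measurable M"
  unfolding position_def by measurable

lemma pred_generation [measurable]: "Measurable.pred M (\<lambda>\<omega>. u \<in> generation N n \<omega>)"
  unfolding generation_def by simp

lemma nn_integral_mark:
  assumes "f \<in> borel_measurable (measure_pmf p \<Otimes>\<^sub>M \<nu>)"
  shows "(\<integral>\<^sup>+\<omega>. f (N u \<omega>, Y u \<omega>) \<partial>M) = (\<integral>\<^sup>+k. (\<integral>\<^sup>+y. f (k, y) \<partial>\<nu>) \<partial>measure_pmf p)"
proof -
  have "(\<integral>\<^sup>+\<omega>. f (N u \<omega>, Y u \<omega>) \<partial>M) = (\<integral>\<^sup>+z. f z \<partial>(measure_pmf p \<Otimes>\<^sub>M \<nu>))"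
  proof -
    have "f \<in> borel_measurable (distr M (measure_pmf p \<Otimes>\<^sub>M \<nu>) (\<lambda>\<omega>. (N u \<omega>, Y u \<omega>)))"
      unfolding law_marks by fact
    from nn_integral_distr[OF measurable_mark this] show ?thesis
      unfolding law_marks by (rule sym)
  qed
  also have "\<dots> = (\<integral>\<^sup>+k. (\<integral>\<^sup>+y. f (k, y) \<partial>\<nu>) \<partial>measure_pmf p)"
    using assms by (rule step.nn_integral_fst[symmetric])
  finally show ?thesis .
qed

lemma nn_integral_offspring:
  "(\<integral>\<^sup>+\<omega>. f (N u \<omega>) \<partial>M) = (\<integral>\<^sup>+k. f k \<partial>measure_pmf p)"
proof -
  have "(\<lambda>z. f (fst z)) \<in> borel_measurable (measure_pmf p \<Otimes>\<^sub>M \<nu>)"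
    by measurable
  from nn_integral_mark[OF this, of u] show ?thesis
    by (simp add: step.emeasure_space_1[simplified])
qed

lemma measurable_brw_set:
  assumes [measurable]: "A \<in> sets borel"
  shows "(\<lambda>\<omega>. {u \<in> generation N n \<omega>. position Y u \<omega> \<in> A}) \<in> M \<rightarrow>\<^sub>M count_space {A. finite A}"
  by (rule measurable_finite_random_set) (auto simp: finite_generation)

lemma measurable_brw_count [measurable]:
  assumes "A \<in> sets borel"
  shows "brw_count N Y n A \<in> M \<rightarrow>\<^sub>M count_space UNIV"
  unfolding brw_count_def
  by (rule measurable_compose[OF measurable_brw_set[OF assms]]) simp

lemma brw_count_1_UNIV: "brw_count N Y 1 UNIV \<omega> = N [] \<omega>"
  by (simp add: brw_count_def generation_Suc generation_0 card_image inj_on_def)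

lemma card_generation_Suc:
  "card (generation N (Suc n) \<omega>) = (\<Sum>u\<in>generation N n \<omega>. N u \<omega>)"
  unfolding generation_Suc
  by (subst card_UN_disjoint) (auto simp: finite_generation card_image inj_on_def)

section \<open>Exponential moments of the generation size\<close>

text \<open>
  The Markov property at generation \<open>n\<close>. Which labels belong to generation \<open>n\<close> is decided by the marks of
  labels shorter than \<open>n\<close>, so on the event that generation \<open>n\<close> equals \<open>A\<close> the offspring numbers
  of the particles in \<open>A\<close> are still independent with law \<open>p\<close>. The proof splits the labels into
  the block of all labels shorter than \<open>n\<close>, indexed by \<open>None\<close>, and one singleton block for each
  element of \<open>A\<close>.
\<close>

lemma nn_integral_indicator_generation:
  fixes h :: "nat \<Rightarrow> ennreal"
  assumes A: "finite A"
  shows "(\<integral>\<^sup>+\<omega>. indicator {A} (generation N n \<omega>) * (\<Prod>u\<in>A. h (N u \<omega>)) \<partial>M) =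
    (\<integral>\<^sup>+\<omega>. indicator {A} (generation N n \<omega>) * (\<integral>\<^sup>+k. h k \<partial>measure_pmf p) ^ card A \<partial>M)"
proof (cases "\<forall>u\<in>A. length u = n")
  case False
  then have "generation N n \<omega> \<noteq> A" for \<omega>
    by (auto simp: generation_def)
  then show ?thesis by simp
next
  case len: True
  define L where "L = insert None (Some ` A)"
  define K where "K j = (case j of None \<Rightarrow> {v. length v < n} | Some u \<Rightarrow> {u})" for j :: "nat list option"
  define P where "P j = PiM (K j) (\<lambda>_. measure_pmf p \<Otimes>\<^sub>M \<nu>)" for j
  define f :: "nat list option \<Rightarrow> (nat list \<Rightarrow> nat \<times> real) \<Rightarrow> ennreal" where
    "f j g = (case j of None \<Rightarrow> indicator {A} (generation (\<lambda>v g. fst (g v)) n g)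
                      | Some u \<Rightarrow> h (fst (g u)))" for j g
  define X where "X j \<omega> = f j (restrict (\<lambda>u. (N u \<omega>, Y u \<omega>)) (K j))" for j \<omega>
  have fst_meas: "(\<lambda>g. fst (g v)) \<in> P j \<rightarrow>\<^sub>M count_space UNIV" if "v \<in> K j" for v j
  proof -
    have "(\<lambda>g. fst (g v)) \<in> P j \<rightarrow>\<^sub>M measure_pmf p"
      unfolding P_def by (rule measurable_compose[OF measurable_component_singleton[OF that] measurable_fst])
    then show ?thesis by simp
  qed
  have f_meas: "f j \<in> borel_measurable (P j)" for j
  proof (cases j)
    case None
    have "Measurable.pred (P None) (\<lambda>g. u \<in> generation (\<lambda>v g. fst (g v)) n g)" for u
    proof (cases "length u = n")
      case True
      have "Measurable.pred (P None) (\<lambda>g. \<forall>i<n. u ! i < fst (g (take i u)))"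
      proof (rule pred_intros_countable(1))
        fix i
        show "Measurable.pred (P None) (\<lambda>g. i < n \<longrightarrow> u ! i < fst (g (take i u)))"
        proof (cases "i < n")
          case i: True
          then have [measurable]: "(\<lambda>g. fst (g (take i u))) \<in> P None \<rightarrow>\<^sub>M count_space UNIV"
            by (intro fst_meas) (auto simp: K_def)
          show ?thesis by measurable
        qed simp
      qed
      also have "(\<lambda>g. \<forall>i<n. u ! i < fst (g (take i u))) = (\<lambda>g. u \<in> generation (\<lambda>v g. fst (g v)) n g)"
        unfolding generation_def using True by blast
      finally show ?thesis .
    next
      case False
      have "Measurable.pred (P None) (\<lambda>g. False)"
        by simp
      also have "(\<lambda>g. False) = (\<lambda>g. u \<in> generation (\<lambda>v g. fst (g v)) n g)"
        unfolding generation_def using False by blast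
      finally show ?thesis .
    qed
    then have "generation (\<lambda>v g. fst (g v)) n \<in> P None \<rightarrow>\<^sub>M count_space {A. finite A}"
      by (intro measurable_finite_random_set finite_generation)
    then have "(\<lambda>g. indicator {A} (generation (\<lambda>v g. fst (g v)) n g) :: ennreal) \<in> borel_measurable (P None)"
      by (rule measurable_compose) simp
    then show ?thesis by (simp add: f_def[abs_def] None)
  next
    case (Some u)
    have "(\<lambda>g. h (fst (g u))) \<in> borel_measurable (P j)"
      by (rule measurable_compose[OF fst_meas]) (auto simp: Some K_def)
    then show ?thesis by (simp add: f_def[abs_def] Some)
  qed
  have "indep_vars P (\<lambda>j \<omega>. restrict (\<lambda>u. (N u \<omega>, Y u \<omega>)) (K j)) L"
    unfolding P_def
    by (rule indep_vars_restrict[OF indep_marks])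
       (use len in \<open>auto simp: disjoint_family_on_def L_def K_def split: option.splits\<close>)
  then have indep: "indep_vars (\<lambda>_. borel) X L"
    unfolding X_def by (rule indep_vars_compose2) (rule f_meas)
  have X_None: "X None \<omega> = indicator {A} (generation N n \<omega>)" for \<omega>
  proof -
    have "generation (\<lambda>v g. fst (g v)) n (restrict (\<lambda>u. (N u \<omega>, Y u \<omega>)) (K None)) = generation N n \<omega>"
      by (rule generation_cong) (simp add: K_def)
    then show ?thesis by (simp add: X_def f_def)
  qed
  have X_Some: "X (Some u) \<omega> = h (N u \<omega>)" for u \<omega>
    by (simp add: X_def f_def K_def)
  have prod_L: "(\<Prod>j\<in>L. g j) = g None * (\<Prod>u\<in>A. g (Some u))" for g :: "_ \<Rightarrow> ennreal"
    using A unfolding L_def by (simp add: prod.reindex)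
  have meas: "(\<lambda>\<omega>. indicator {A} (generation N n \<omega>) :: ennreal) \<in> borel_measurable M"
    using indep unfolding X_None[abs_def, symmetric] by (auto simp: indep_vars_def L_def)
  have "(\<integral>\<^sup>+\<omega>. (\<Prod>j\<in>L. X j \<omega>) \<partial>M) = (\<Prod>j\<in>L. \<integral>\<^sup>+\<omega>. X j \<omega> \<partial>M)"
    using A by (intro indep_vars_nn_integral indep) (auto simp: L_def)
  then show ?thesis
    unfolding prod_L X_None X_Some nn_integral_offspring
    by (simp add: nn_integral_multc meas)
qed

text \<open>
  With \<open>h k = s ^ k\<close> this is the classical recursion for the generating functions of a
  Galton--Watson process.
\<close>

lemma nn_integral_prod_generation:
  fixes h :: "nat \<Rightarrow> ennreal"
  shows "(\<integral>\<^sup>+\<omega>. (\<Prod>u\<in>generation N n \<omega>. h (N u \<omega>)) \<partial>M) =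
    (\<integral>\<^sup>+\<omega>. (\<integral>\<^sup>+k. h k \<partial>measure_pmf p) ^ card (generation N n \<omega>) \<partial>M)"
proof -
  have S: "generation N n \<in> M \<rightarrow>\<^sub>M count_space {A. finite A}"
    by (intro measurable_finite_random_set finite_generation) simp
  have "(\<integral>\<^sup>+\<omega>. (\<Prod>u\<in>generation N n \<omega>. h (N u \<omega>)) \<partial>M) = (\<integral>\<^sup>+A.
      (\<integral>\<^sup>+\<omega>. indicator {A} (generation N n \<omega>) * (\<Prod>u\<in>A. h (N u \<omega>)) \<partial>M) \<partial>count_space {A. finite A})"
    by (rule nn_integral_split_finite_random_set[OF S]) measurable
  also have "\<dots> = (\<integral>\<^sup>+A. (\<integral>\<^sup>+\<omega>. indicator {A} (generation N n \<omega>) *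
      (\<integral>\<^sup>+k. h k \<partial>measure_pmf p) ^ card A \<partial>M) \<partial>count_space {A. finite A})"
    by (intro nn_integral_cong nn_integral_indicator_generation) simp
  also have "\<dots> = (\<integral>\<^sup>+\<omega>. (\<integral>\<^sup>+k. h k \<partial>measure_pmf p) ^ card (generation N n \<omega>) \<partial>M)"
    by (rule nn_integral_split_finite_random_set[OF S, symmetric]) measurable
  finally show ?thesis .
qed

text \<open>
  One generation replaces the parameter \<open>t\<close> by at most \<open>c * t\<close>; the condition \<open>t * c ^ n \<le> t0\<close>
  keeps all \<open>n\<close> successive parameters in the range where the one-step bound is available.
\<close>

lemma mgf_generation_bound:
  fixes c t t0 :: real
  assumes c: "1 \<le> c"
    and t0: "\<And>t. 0 < t \<Longrightarrow> t \<le> t0 \<Longrightarrow> (\<integral>\<^sup>+\<omega>. ennreal (exp (t * real (N [] \<omega>))) \<partial>M) \<le> ennreal (exp (c * t))"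
    and "0 < t" "t * c ^ n \<le> t0"
  shows "(\<integral>\<^sup>+\<omega>. ennreal (exp (t * real (card (generation N n \<omega>)))) \<partial>M) \<le> ennreal (exp (t * c ^ n))"
  using assms(3,4)
proof (induction n arbitrary: t)
  case 0
  then show ?case by (simp add: generation_0 emeasure_space_1)
next
  case (Suc n)
  have "t \<le> t * c ^ Suc n"
    using c Suc.prems(1) mult_left_mono[OF one_le_power[OF c, of "Suc n"], of t] by simp
  then have t: "t \<le> t0"
    using Suc.prems by linarith
  have "(\<integral>\<^sup>+\<omega>. ennreal (exp (t * real (card (generation N (Suc n) \<omega>)))) \<partial>M)
      = (\<integral>\<^sup>+\<omega>. (\<Prod>u\<in>generation N n \<omega>. ennreal (exp (t * real (N u \<omega>)))) \<partial>M)"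
    by (simp add: card_generation_Suc sum_distrib_left exp_sum finite_generation prod_ennreal)
  also have "\<dots> = (\<integral>\<^sup>+\<omega>. (\<integral>\<^sup>+k. ennreal (exp (t * real k)) \<partial>measure_pmf p) ^ card (generation N n \<omega>) \<partial>M)"
    by (rule nn_integral_prod_generation)
  also have "\<dots> \<le> (\<integral>\<^sup>+\<omega>. ennreal (exp (c * t)) ^ card (generation N n \<omega>) \<partial>M)"
    using t0[OF Suc.prems(1) t] by (intro nn_integral_mono power_mono) (auto simp: nn_integral_offspring[where u="[]", symmetric])
  also have "\<dots> = (\<integral>\<^sup>+\<omega>. ennreal (exp ((c * t) * real (card (generation N n \<omega>)))) \<partial>M)"
    by (simp add: ennreal_power exp_of_nat_mult[symmetric] mult.commute)
  also have "\<dots> \<le> ennreal (exp ((c * t) * c ^ n))"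
    using Suc.prems c by (intro Suc.IH) (auto simp: mult_ac)
  finally show ?case by (simp add: mult_ac)
qed

section \<open>First moment with exponential weights\<close>

text \<open>
  A label is present and weighted according to the marks on its ancestral line, and these are
  independent. Along the line the offspring number of the last label and the step of the root do not
  enter, so the mark of the prefix of length \<open>i\<close> contributes an offspring factor \<open>b i\<close> only for
  \<open>i < n\<close> and a step factor \<open>d i\<close> only for \<open>i > 0\<close>.
\<close>

lemma nn_integral_label:
  fixes l :: real and u :: "nat list"
  shows "(\<integral>\<^sup>+\<omega>. indicator (generation N (length u) \<omega>) u * ennreal (exp (l * position Y u \<omega>)) \<partial>M) =
    (\<Prod>i<length u. \<integral>\<^sup>+k. indicator {..<k} (u ! i) \<partial>measure_pmf p) * (\<integral>\<^sup>+y. ennreal (exp (l * y)) \<partial>\<nu>) ^ length u"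
proof -
  define n where "n = length u"
  define J where "J = (\<lambda>i. take i u) ` {..n}"
  define b :: "nat \<Rightarrow> nat \<Rightarrow> ennreal" where "b i k = (if i < n then indicator {..<k} (u ! i) else 1)" for i k
  define d :: "nat \<Rightarrow> real \<Rightarrow> ennreal" where "d i y = (if i = 0 then 1 else ennreal (exp (l * y)))" for i y
  define X where "X v \<omega> = b (length v) (N v \<omega>) * d (length v) (Y v \<omega>)" for v \<omega>
  have inj: "inj_on (\<lambda>i. take i u) {..n}"
    by (rule inj_on_inverseI[where g = length]) (simp add: n_def min_absorb2)
  have prod_J: "(\<Prod>v\<in>J. g v) = (\<Prod>i\<le>n. g (take i u))" for g :: "_ \<Rightarrow> ennreal"
    unfolding J_def by (simp add: prod.reindex[OF inj])
  have prod_b: "(\<Prod>i\<le>n. if i < n then g i else 1) = (\<Prod>i<n. g i)" for g :: "_ \<Rightarrow> ennreal"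
    by (simp add: lessThan_Suc_atMost[symmetric])
  have prod_d: "(\<Prod>i\<le>n. if i = 0 then 1 else g i) = (\<Prod>i<n. g (Suc i))" for g :: "_ \<Rightarrow> ennreal"
    by (simp add: prod.atMost_shift)
  have meas: "(\<lambda>z. b i (fst z) * d i (snd z)) \<in> borel_measurable (measure_pmf p \<Otimes>\<^sub>M \<nu>)" for i
  proof -
    have [measurable]: "d i \<in> borel_measurable \<nu>"
      by (cases "i = 0") (auto simp: d_def[abs_def])
    show ?thesis by measurable
  qed
  have "indep_vars (\<lambda>_. borel) (\<lambda>v \<omega>. (\<lambda>z. b (length v) (fst z) * d (length v) (snd z)) (N v \<omega>, Y v \<omega>)) J"
    by (rule indep_vars_compose2[OF indep_vars_subset[OF indep_marks]]) (use meas in auto)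
  then have indep: "indep_vars (\<lambda>_. borel) X J"
    by (simp add: X_def[abs_def])
  have EX: "(\<integral>\<^sup>+\<omega>. X v \<omega> \<partial>M) =
      (\<integral>\<^sup>+k. b (length v) k \<partial>measure_pmf p) * (\<integral>\<^sup>+y. d (length v) y \<partial>\<nu>)" for v
  proof -
    have [measurable]: "d i \<in> borel_measurable \<nu>" for i
      by (cases "i = 0") (auto simp: d_def[abs_def])
    show ?thesis
      using nn_integral_mark[OF meas[of "length v"], of v]
      by (simp add: X_def nn_integral_cmult nn_integral_multc)
  qed
  have pathwise: "(\<Prod>v\<in>J. X v \<omega>) = indicator (generation N n \<omega>) u * ennreal (exp (l * position Y u \<omega>))" for \<omega>
  proof -
    have "(\<Prod>v\<in>J. X v \<omega>) = (\<Prod>i\<le>n. b i (N (take i u) \<omega>)) * (\<Prod>i\<le>n. d i (Y (take i u) \<omega>))"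
      unfolding prod_J X_def prod.distrib[symmetric] by (intro prod.cong) (auto simp: n_def min_absorb2)
    also have "(\<Prod>i\<le>n. b i (N (take i u) \<omega>)) = (\<Prod>i<n. indicator {..<N (take i u) \<omega>} (u ! i))"
      unfolding b_def by (rule prod_b)
    also have "\<dots> = indicator (generation N n \<omega>) u"
      by (cases "u \<in> generation N n \<omega>") (auto simp: generation_def n_def indicator_def)
    also have "(\<Prod>i\<le>n. d i (Y (take i u) \<omega>)) = (\<Prod>i<n. ennreal (exp (l * Y (take (Suc i) u) \<omega>)))"
      unfolding d_def by (rule prod_d)
    also have "\<dots> = ennreal (exp (l * position Y u \<omega>))"
      by (simp add: prod_ennreal exp_sum[symmetric] position_def sum_distrib_left n_def sum.atLeast1_atMost_eq)
    finally show ?thesis .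
  qed
  have "(\<integral>\<^sup>+\<omega>. (\<Prod>v\<in>J. X v \<omega>) \<partial>M) = (\<Prod>v\<in>J. \<integral>\<^sup>+\<omega>. X v \<omega> \<partial>M)"
    by (intro indep_vars_nn_integral indep) (auto simp: J_def)
  also have "\<dots> = (\<Prod>i\<le>n. \<integral>\<^sup>+k. b i k \<partial>measure_pmf p) * (\<Prod>i\<le>n. \<integral>\<^sup>+y. d i y \<partial>\<nu>)"
    unfolding prod_J EX prod.distrib[symmetric] by (intro prod.cong) (auto simp: n_def min_absorb2)
  also have "(\<Prod>i\<le>n. \<integral>\<^sup>+k. b i k \<partial>measure_pmf p) = (\<Prod>i<n. \<integral>\<^sup>+k. indicator {..<k} (u ! i) \<partial>measure_pmf p)"
    unfolding prod_b[symmetric] by (intro prod.cong) (auto simp: b_def)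
  also have "(\<Prod>i\<le>n. \<integral>\<^sup>+y. d i y \<partial>\<nu>) = (\<Prod>i<n. \<integral>\<^sup>+y. ennreal (exp (l * y)) \<partial>\<nu>)"
    unfolding prod_d[of "\<lambda>_. \<integral>\<^sup>+y. ennreal (exp (l * y)) \<partial>\<nu>", symmetric] by (intro prod.cong) (auto simp: d_def step.emeasure_space_1[simplified])
  finally show ?thesis
    by (simp add: pathwise n_def)
qed

text \<open>
  Summing the weights of the single labels factorises over the letters, and the sum of the tail
  probabilities \<open>P(k > j)\<close> over \<open>j\<close> is the mean offspring number.
\<close>

lemma many_to_one_exp:
  "(\<integral>\<^sup>+\<omega>. (\<Sum>u\<in>generation N n \<omega>. ennreal (exp (l * position Y u \<omega>))) \<partial>M) =
    ((\<integral>\<^sup>+k. of_nat k \<partial>measure_pmf p) * (\<integral>\<^sup>+y. ennreal (exp (l * y)) \<partial>\<nu>)) ^ n"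
proof -
  let ?L = "{u :: nat list. length u = n}"
  let ?w = "\<lambda>u \<omega>. indicator (generation N n \<omega>) u * ennreal (exp (l * position Y u \<omega>))"
  let ?q = "\<lambda>j. \<integral>\<^sup>+k. indicator {..<k} j \<partial>measure_pmf p"
  have [measurable]: "?w u \<in> borel_measurable M" for u
    by measurable
  have "(\<Sum>u\<in>generation N n \<omega>. ennreal (exp (l * position Y u \<omega>))) = (\<integral>\<^sup>+u. ?w u \<omega> \<partial>count_space ?L)" for \<omega>
  proof -
    have "(\<integral>\<^sup>+u. ?w u \<omega> \<partial>count_space ?L) = (\<Sum>u | u \<in> ?L \<and> 0 < ?w u \<omega>. ?w u \<omega>)"
      by (rule nn_integral_count_space)
         (auto intro: finite_subset[OF _ finite_generation[of N n \<omega>]] split: split_indicator_asm)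
    also have "\<dots> = (\<Sum>u\<in>generation N n \<omega>. ennreal (exp (l * position Y u \<omega>)))"
      by (rule sum.cong) (auto simp: generation_def indicator_def)
    finally show ?thesis ..
  qed
  then have "(\<integral>\<^sup>+\<omega>. (\<Sum>u\<in>generation N n \<omega>. ennreal (exp (l * position Y u \<omega>))) \<partial>M)
      = (\<integral>\<^sup>+\<omega>. (\<integral>\<^sup>+u. ?w u \<omega> \<partial>count_space ?L) \<partial>M)"
    by simp
  also have "\<dots> = (\<integral>\<^sup>+u. (\<integral>\<^sup>+\<omega>. ?w u \<omega> \<partial>M) \<partial>count_space ?L)"
    by (rule nn_integral_count_space_nn_integral) auto
  also have "\<dots> = (\<integral>\<^sup>+u. (\<Prod>i<n. ?q (u ! i)) * (\<integral>\<^sup>+y. ennreal (exp (l * y)) \<partial>\<nu>) ^ n \<partial>count_space ?L)"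
    by (intro nn_integral_cong) (use nn_integral_label in auto)
  also have "\<dots> = (\<integral>\<^sup>+j. ?q j \<partial>count_space UNIV) ^ n * (\<integral>\<^sup>+y. ennreal (exp (l * y)) \<partial>\<nu>) ^ n"
    by (simp add: nn_integral_multc nn_integral_lists_prod[where q = ?q])
  also have "(\<integral>\<^sup>+j. ?q j \<partial>count_space UNIV) = (\<integral>\<^sup>+k. (\<integral>\<^sup>+j. indicator {..<k} j \<partial>count_space UNIV) \<partial>measure_pmf p)"
    by (rule nn_integral_count_space_nn_integral[symmetric]) auto
  also have "\<dots> = (\<integral>\<^sup>+k. of_nat k \<partial>measure_pmf p)"
    by simp
  finally show ?thesis
    by (simp add: power_mult_distrib)
qed

text \<open>
  Markov's inequality: each particle to the right of \<open>x * n\<close> has weight at least \<open>exp (l * x * n)\<close>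
  in the sum of \<open>many_to_one_exp\<close>.
\<close>

lemma prob_brw_count_le_many_to_one:
  fixes a c l m x :: real
  assumes mean: "(\<integral>\<^sup>+k. of_nat k \<partial>measure_pmf p) = ennreal m" and m: "0 < m" "ln m \<le> a"
    and l: "0 < l" "(\<integral>\<^sup>+y. ennreal (exp (l * y)) \<partial>\<nu>) \<le> ennreal (exp (c * l))"
  shows "prob {\<omega> \<in> space M. real (brw_count N Y n {x * real n..} \<omega>) \<ge> exp (a * real n)}
    \<le> exp (- ((x - c) * l * real n))"
proof -
  define E where "E = {\<omega> \<in> space M. real (brw_count N Y n {x * real n..} \<omega>) \<ge> exp (a * real n)}"
  have [measurable]: "E \<in> sets M"
    unfolding E_def by measurable
  define R where "R = exp (a * real n) * exp (l * (x * real n))"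
  have ineq: "ennreal R * indicator E \<omega> \<le> (\<Sum>u\<in>generation N n \<omega>. ennreal (exp (l * position Y u \<omega>)))" for \<omega>
  proof (cases "\<omega> \<in> E")
    case True
    let ?S = "{u \<in> generation N n \<omega>. position Y u \<omega> \<in> {x * real n..}}"
    have "R \<le> real (card ?S) * exp (l * (x * real n))"
      using True by (simp add: R_def E_def brw_count_def)
    also have "\<dots> = (\<Sum>u\<in>?S. exp (l * (x * real n)))"
      by simp
    also have "\<dots> \<le> (\<Sum>u\<in>?S. exp (l * position Y u \<omega>))"
      using l by (intro sum_mono) auto
    also have "\<dots> \<le> (\<Sum>u\<in>generation N n \<omega>. exp (l * position Y u \<omega>))"
      by (intro sum_mono2 finite_generation) auto
    finally show ?thesis
      using True by (simp add: sum_ennreal ennreal_leI)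
  qed simp
  have "ennreal (R * prob E) = ennreal R * emeasure M E"
    by (simp add: emeasure_eq_measure ennreal_mult R_def)
  also have "\<dots> = (\<integral>\<^sup>+\<omega>. ennreal R * indicator E \<omega> \<partial>M)"
    by (simp add: nn_integral_cmult_indicator)
  also have "\<dots> \<le> (\<integral>\<^sup>+\<omega>. (\<Sum>u\<in>generation N n \<omega>. ennreal (exp (l * position Y u \<omega>))) \<partial>M)"
    by (intro nn_integral_mono ineq)
  also have "\<dots> = (ennreal m * (\<integral>\<^sup>+y. ennreal (exp (l * y)) \<partial>\<nu>)) ^ n"
    unfolding many_to_one_exp mean ..
  also have "\<dots> \<le> (ennreal m * ennreal (exp (c * l))) ^ n"
    using l by (intro power_mono mult_left_mono) auto
  also have "\<dots> = ennreal ((m * exp (c * l)) ^ n)"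
    using m by (subst ennreal_mult[symmetric]) (auto simp: ennreal_power)
  finally have "R * prob E \<le> (m * exp (c * l)) ^ n"
    using m by (simp add: ennreal_le_iff)
  also have "\<dots> \<le> (exp a * exp (c * l)) ^ n"
    using m by (intro power_mono mult_right_mono) (auto simp flip: ln_le_cancel_iff)
  also have "\<dots> = R * exp (- ((x - c) * l * real n))"
    by (simp add: R_def exp_of_nat_mult[symmetric] exp_add[symmetric] algebra_simps)
  finally show ?thesis
    by (simp add: R_def E_def)
qed

section \<open>Upper tail from the generation size\<close>

text \<open>
  Markov's inequality with the largest parameter that \<open>mgf_generation_bound\<close> admits, namely
  \<open>t0 / c ^ n\<close>. The bound decays doubly exponentially in \<open>n\<close> once \<open>c < exp a\<close>.
\<close>

lemma prob_brw_count_le_mgf: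
  fixes a c t0 :: real
  assumes c: "1 \<le> c" and A: "A \<in> sets borel" and t0: "0 < t0"
    "\<And>t. 0 < t \<Longrightarrow> t \<le> t0 \<Longrightarrow> (\<integral>\<^sup>+\<omega>. ennreal (exp (t * real (N [] \<omega>))) \<partial>M) \<le> ennreal (exp (c * t))"
  shows "prob {\<omega> \<in> space M. real (brw_count N Y n A \<omega>) \<ge> exp (a * real n)}
    \<le> exp (- (t0 * ((exp a / c) ^ n - 1)))"
proof -
  define E where "E = {\<omega> \<in> space M. real (brw_count N Y n A \<omega>) \<ge> exp (a * real n)}"
  have [measurable]: "E \<in> sets M"
    unfolding E_def using A by measurable
  define t where "t = t0 / c ^ n"
  have t: "0 < t" "t * c ^ n = t0"
    using c t0 by (auto simp: t_def)
  have ineq: "ennreal (exp (t * exp (a * real n))) * indicator E \<omega> \<le> ennreal (exp (t * real (card (generation N n \<omega>))))" for \<omega>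
  proof (cases "\<omega> \<in> E")
    case True
    have "brw_count N Y n A \<omega> \<le> card (generation N n \<omega>)"
      unfolding brw_count_def by (intro card_mono finite_generation) auto
    then have "exp (a * real n) \<le> real (card (generation N n \<omega>))"
      using True by (simp add: E_def)
    then show ?thesis
      using True t by (simp add: ennreal_leI)
  qed simp
  have "ennreal (exp (t * exp (a * real n)) * prob E) = ennreal (exp (t * exp (a * real n))) * emeasure M E"
    by (simp add: emeasure_eq_measure ennreal_mult)
  also have "\<dots> = (\<integral>\<^sup>+\<omega>. ennreal (exp (t * exp (a * real n))) * indicator E \<omega> \<partial>M)"
    by (simp add: nn_integral_cmult_indicator)
  also have "\<dots> \<le> (\<integral>\<^sup>+\<omega>. ennreal (exp (t * real (card (generation N n \<omega>)))) \<partial>M)"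
    by (intro nn_integral_mono ineq)
  also have "\<dots> \<le> ennreal (exp (t * c ^ n))"
    using t by (intro mgf_generation_bound[OF c t0(2)]) auto
  finally have "exp (t * exp (a * real n)) * prob E \<le> exp t0"
    using t by (simp add: ennreal_le_iff)
  then have "prob E \<le> exp (t0 - t * exp (a * real n))"
    by (simp add: exp_diff field_simps)
  also have "t0 - t * exp (a * real n) = - (t0 * ((exp a / c) ^ n - 1))"
    by (simp add: t_def power_divide exp_of_nat2_mult[symmetric] algebra_simps)
  finally show ?thesis
    by (simp add: E_def)
qed

section \<open>Forcing a regular tree with large steps\<close>

text \<open>
  The favourable event asks for \<open>\<alpha>\<close> children and a step of at least \<open>x\<close> at every word of length at most
  \<open>n\<close> over the alphabet \<open>{..<\<alpha>}\<close>. Asking this also for the step of the root and the offspring of the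
  last generation costs only further factors of the same kind and treats all words alike.
\<close>

lemma prob_full_tree_ge:
  fixes \<alpha> n :: nat and x :: real
  shows "(pmf p \<alpha> * measure \<nu> {x..}) ^ (\<Sum>i\<le>n. \<alpha> ^ i)
    \<le> prob {\<omega> \<in> space M. real (brw_count N Y n {x * real n..} \<omega>) \<ge> real \<alpha> ^ n}"
proof -
  define W where "W = {u. set u \<subseteq> {..<\<alpha>} \<and> length u \<le> n}"
  define B where "B = {\<alpha>} \<times> {x..}"
  define X where "X u \<omega> = (N u \<omega>, Y u \<omega>)" for u \<omega>
  have W: "finite W" "[] \<in> W" "card W = (\<Sum>i\<le>n. \<alpha> ^ i)"
    unfolding W_def by (simp_all add: finite_lists_length_le card_lists_length_le)
  have B: "B \<in> sets (measure_pmf p \<Otimes>\<^sub>M \<nu>)"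
    unfolding B_def by simp
  have X: "X u \<in> M \<rightarrow>\<^sub>M measure_pmf p \<Otimes>\<^sub>M \<nu>" for u
    unfolding X_def[abs_def] by (rule measurable_mark)
  have prob_X: "prob (X u -` B \<inter> space M) = pmf p \<alpha> * measure \<nu> {x..}" for u
  proof -
    have "prob (X u -` B \<inter> space M) = measure (measure_pmf p \<Otimes>\<^sub>M \<nu>) B"
      using measure_distr[OF X B, of u] law_marks[of u] by (simp add: X_def[abs_def])
    also have "\<dots> = pmf p \<alpha> * measure \<nu> {x..}"
      unfolding B_def measure_def
      by (subst step.emeasure_pair_measure_Times) (simp_all add: enn2real_mult emeasure_pmf_single)
    finally show ?thesis .
  qed
  have "(pmf p \<alpha> * measure \<nu> {x..}) ^ (\<Sum>i\<le>n. \<alpha> ^ i) = (\<Prod>u\<in>W. prob (X u -` B \<inter> space M))"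
    by (simp add: prob_X W)
  also have "\<dots> = prob (\<Inter>u\<in>W. X u -` B \<inter> space M)"
    using indep_marks W B unfolding X_def[abs_def] by (intro indep_varsD[symmetric]) auto
  also have "\<dots> \<le> prob {\<omega> \<in> space M. real (brw_count N Y n {x * real n..} \<omega>) \<ge> real \<alpha> ^ n}"
  proof (rule finite_measure_mono)
    show "{\<omega> \<in> space M. real (brw_count N Y n {x * real n..} \<omega>) \<ge> real \<alpha> ^ n} \<in> events"
      by measurable
    show "(\<Inter>u\<in>W. X u -` B \<inter> space M) \<subseteq>
        {\<omega> \<in> space M. real (brw_count N Y n {x * real n..} \<omega>) \<ge> real \<alpha> ^ n}"
    proof
      fix \<omega> assume \<omega>: "\<omega> \<in> (\<Inter>u\<in>W. X u -` B \<inter> space M)"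
      then have "(N u \<omega>, Y u \<omega>) \<in> B" if "u \<in> W" for u
        using that unfolding X_def by blast
      then have N: "N u \<omega> = \<alpha>" and Y: "x \<le> Y u \<omega>" if "u \<in> W" for u
        using that by (auto simp: B_def)
      have space: "\<omega> \<in> space M"
        using \<omega> W(2) by blast
      have take: "take i u \<in> W" if "set u \<subseteq> {..<\<alpha>}" "length u = n" for i u
        using that set_take_subset[of i u] by (auto simp: W_def)
      have "{u. set u \<subseteq> {..<\<alpha>} \<and> length u = n} \<subseteq> {u \<in> generation N n \<omega>. position Y u \<omega> \<in> {x * real n..}}"
      proof safe
        fix u :: "nat list" assume u: "set u \<subseteq> {..<\<alpha>}" "n = length u"
        show "u \<in> generation N (length u) \<omega>"
          using u N[OF take[OF u(1)]] by (auto simp: generation_def subset_iff)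
        have "(\<Sum>i = 1..length u. x) \<le> position Y u \<omega>"
          unfolding position_def using u by (intro sum_mono Y take) auto
        then show "x * real (length u) \<le> position Y u \<omega>"
          by (simp add: mult.commute)
      qed
      then have "card {u. set u \<subseteq> {..<\<alpha>} \<and> length u = n} \<le> brw_count N Y n {x * real n..} \<omega>"
        unfolding brw_count_def by (intro card_mono) (auto simp: finite_generation)
      then have "\<alpha> ^ n \<le> brw_count N Y n {x * real n..} \<omega>"
        by (simp add: card_lists_length_eq)
      then have "real (\<alpha> ^ n) \<le> real (brw_count N Y n {x * real n..} \<omega>)"
        by (simp only: of_nat_le_iff)
      then show "\<omega> \<in> {\<omega> \<in> space M. real (brw_count N Y n {x * real n..} \<omega>) \<ge> real \<alpha> ^ n}"
        using space by simp
    qed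
  qed
  finally show ?thesis .
qed

end

section \<open>The double logarithmic scale\<close>

lemma ext_ln_le: "y \<le> ereal b \<Longrightarrow> 0 < b \<Longrightarrow> ext_ln y \<le> ereal (ln b)"
  by (cases y) (auto simp: ext_ln_def)

lemma ext_ln_ge: "ereal b \<le> y \<Longrightarrow> 0 < b \<Longrightarrow> ereal (ln b) \<le> ext_ln y"
  by (cases y) (auto simp: ext_ln_def)

text \<open>
  Comparison in this form covers probabilities \<open>0\<close> and \<open>1\<close>, where the inner or outer logarithm
  is infinite.
\<close>

lemma double_log_ge:
  assumes "P \<le> exp (- b)" "0 < b"
  shows "ereal (ln b) \<le> ext_ln (- ext_ln (ereal P))"
proof (rule ext_ln_ge)
  have "ext_ln (ereal P) \<le> ereal (- b)"
    using ext_ln_le[of "ereal P" "exp (- b)"] assms by simp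
  then have "- ereal (- b) \<le> - ext_ln (ereal P)"
    unfolding ereal_minus_le_minus .
  then show "ereal b \<le> - ext_ln (ereal P)"
    by simp
qed fact

lemma double_log_le:
  assumes "exp (- b) \<le> P" "0 < b"
  shows "ext_ln (- ext_ln (ereal P)) \<le> ereal (ln b)"
proof (rule ext_ln_le)
  have "ereal (- b) \<le> ext_ln (ereal P)"
    using ext_ln_ge[of "exp (- b)" "ereal P"] assms by simp
  then show "- ext_ln (ereal P) \<le> ereal b"
    using ereal_uminus_le_reorder by auto
qed fact

lemma le_liminf_double_log:
  assumes "\<forall>\<^sub>F n in sequentially. 0 < b n \<and> P n \<le> exp (- b n)"
    and "(\<lambda>n. ln (b n) / real n) \<longlonglongrightarrow> c"
  shows "ereal c \<le> liminf (\<lambda>n. ereal (1 / real n) * ext_ln (- ext_ln (ereal (P n))))"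
proof -
  have "ereal c = liminf (\<lambda>n. ereal (ln (b n) / real n))"
    using assms(2) by (intro lim_imp_Liminf[symmetric]) auto
  also have "\<dots> \<le> liminf (\<lambda>n. ereal (1 / real n) * ext_ln (- ext_ln (ereal (P n))))"
  proof (rule Liminf_mono, use assms(1) in eventually_elim)
    case (elim n)
    then show ?case
      using ereal_mult_left_mono[OF double_log_ge[of "P n" "b n"], of "ereal (1 / real n)"] by simp
  qed
  finally show ?thesis .
qed

lemma limsup_double_log_le:
  assumes "\<forall>\<^sub>F n in sequentially. 0 < b n \<and> exp (- b n) \<le> P n"
    and "(\<lambda>n. ln (b n) / real n) \<longlonglongrightarrow> c"
  shows "limsup (\<lambda>n. ereal (1 / real n) * ext_ln (- ext_ln (ereal (P n)))) \<le> ereal c"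
proof -
  have "limsup (\<lambda>n. ereal (1 / real n) * ext_ln (- ext_ln (ereal (P n)))) \<le> limsup (\<lambda>n. ereal (ln (b n) / real n))"
  proof (rule Limsup_mono, use assms(1) in eventually_elim)
    case (elim n)
    then show ?case
      using ereal_mult_left_mono[OF double_log_le[of "b n" "P n"], of "ereal (1 / real n)"] by simp
  qed
  also have "\<dots> = ereal c"
    using assms(2) by (intro lim_imp_Limsup) auto
  finally show ?thesis .
qed

text \<open>
  If no possible offspring number reached \<open>exp a\<close>, the support would be finite, its largest element
  would be the supremum of the offspring numbers, and its logarithm would be smaller than \<open>a\<close>.
\<close>

lemma min_offspring_above_in_support:
  assumes "pmf p 0 = 0" and a: "ereal a \<le> ext_ln (max_offspring p)"
  shows "0 < pmf p (min_offspring_above p a)" "exp a \<le> real (min_offspring_above p a)"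
proof -
  define K where "K = {k. pmf p k > 0 \<and> real k \<ge> exp a}"
  have "K \<noteq> {}"
  proof
    assume K: "K = {}"
    have small: "real k < exp a" if "k \<in> set_pmf p" for k
      using K that by (auto simp: K_def set_pmf_iff pmf_positive not_le[symmetric])
    have "finite (set_pmf p)"
    proof (rule finite_subset)
      show "set_pmf p \<subseteq> {..nat \<lceil>exp a\<rceil>}"
        using small by (fastforce intro: less_imp_le simp: le_nat_iff le_ceiling_iff)
    qed simp
    then have Max: "Max (set_pmf p) \<in> set_pmf p" "\<And>k. k \<in> set_pmf p \<Longrightarrow> k \<le> Max (set_pmf p)"
      by (auto simp: set_pmf_not_empty)
    have pos: "0 < Max (set_pmf p)"
      using Max(1) assms(1) by (metis gr0I set_pmf_iff)
    have "max_offspring p \<le> ereal (real (Max (set_pmf p)))"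
      unfolding max_offspring_def using Max(2) by (auto intro!: Sup_least simp: set_pmf_iff)
    then have "ereal a \<le> ereal (ln (real (Max (set_pmf p))))"
      using order_trans[OF a ext_ln_le] pos by simp
    then have "exp a \<le> real (Max (set_pmf p))"
      using pos by (simp add: ln_ge_iff)
    then show False
      using small[OF Max(1)] by simp
  qed
  then have "min_offspring_above p a \<in> K"
    unfolding min_offspring_above_def K_def by (rule Inf_nat_def1)
  then show "0 < pmf p (min_offspring_above p a)" "exp a \<le> real (min_offspring_above p a)"
    by (auto simp: K_def)
qed

lemma measure_atLeast_pos_if_less_ess_sup:
  assumes "real_distribution \<nu>" "ereal x < ess_sup \<nu>"
  shows "0 < measure \<nu> {x..}"
proof -
  interpret real_distribution \<nu> by fact
  obtain z where "x < z" "0 < measure \<nu> {z<..}"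
    using assms(2) by (auto simp: ess_sup_def less_Sup_iff)
  moreover have "measure \<nu> {z<..} \<le> measure \<nu> {x..}"
    using \<open>x < z\<close> by (intro finite_measure_mono) auto
  ultimately show ?thesis by linarith
qed

section \<open>Growth rates of the upper deviation probabilities\<close>

theorem theorem1p3:
  fixes M :: "'w measure" and p :: "nat pmf" and \<nu> :: "real measure"
    and N :: "nat list \<Rightarrow> 'w \<Rightarrow> nat" and Y :: "nat list \<Rightarrow> 'w \<Rightarrow> real"
    and m a x :: real
  assumes "branching_random_walk M p \<nu> N Y"
    and "pmf p 0 = 0"
    and "integrable M (\<lambda>\<omega>. real (brw_count N Y 1 UNIV \<omega>))"
    and "m = (\<integral>\<omega>. real (brw_count N Y 1 UNIV \<omega>) \<partial>M)"
    and "1 < m"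
    and "integrable \<nu> (\<lambda>y. y)" and "(\<integral>y. y \<partial>\<nu>) = 0"
    and "measure \<nu> {0} < 1"
    and "\<exists>\<kappa>>0. integrable \<nu> (\<lambda>y. exp (\<kappa> * y))"
    and "\<exists>\<theta>>0. integrable M (\<lambda>\<omega>. exp (\<theta> * real (brw_count N Y 1 UNIV \<omega>)))"
    and "\<forall>k\<ge>2. pmf p k < 1"
    and "0 < x" and "ereal x < ess_sup \<nu>"
    and "ln m \<le> a" and "ereal a \<le> ext_ln (max_offspring p)"
  shows "let r = (\<lambda>n. ereal (1 / real n) * ext_ln (- ext_ln (ereal (measure M
            {\<omega> \<in> space M. real (brw_count N Y n {x * real n..} \<omega>) \<ge> exp (a * real n)}))))
    in ereal (a - ln m) \<le> liminf r \<and> liminf r \<le> limsup r \<and>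
       limsup r \<le> ereal (ln (real (min_offspring_above p a)))"
proof -
  interpret branching_random_walk M p \<nu> N Y by fact
  define P where "P n = prob {\<omega> \<in> space M. real (brw_count N Y n {x * real n..} \<omega>) \<ge> exp (a * real n)}" for n
  let ?r = "\<lambda>n. ereal (1 / real n) * ext_ln (- ext_ln (ereal (P n)))"
  have int_N: "integrable M (\<lambda>\<omega>. real (N [] \<omega>))" and mean_N: "expectation (\<lambda>\<omega>. real (N [] \<omega>)) = m"
    using assms(3,4) unfolding brw_count_1_UNIV by simp_all
  obtain \<theta> where \<theta>: "0 < \<theta>" "integrable M (\<lambda>\<omega>. exp (\<theta> * real (N [] \<omega>)))"
    using assms(10) unfolding brw_count_1_UNIV by auto
  obtain \<kappa> where \<kappa>: "0 < \<kappa>" "integrable \<nu> (\<lambda>y. exp (\<kappa> * y))"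
    using assms(9) by auto

  have lower_if_gt: "ereal (a - ln m) \<le> liminf ?r" if "ln m < a"
  proof (rule dense_le_bounded)
    show "0 < ereal (a - ln m)"
      using that by simp
    fix w assume w: "0 < w" "w < ereal (a - ln m)"
    then obtain s where s: "w = ereal s" "0 < s" "s < a - ln m"
      by (cases w) auto
    \<comment> \<open>With this choice the bound from the generation size has rate exactly \<open>s\<close>.\<close>
    define c where "c = exp (a - s)"
    have c: "m < c"
      using s assms(5) by (simp add: c_def flip: ln_less_cancel_iff)
    obtain t0 where t0: "0 < t0" "\<And>t. 0 < t \<Longrightarrow> t \<le> t0 \<Longrightarrow>
        (\<integral>\<^sup>+\<omega>. ennreal (exp (t * real (N [] \<omega>))) \<partial>M) \<le> ennreal (exp (c * t))"
      using mgf_le_exp_near_zero[OF int_N \<theta>, of c] c mean_N by metis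
    have ratio: "exp a / c = exp s"
      by (simp add: c_def exp_diff)
    show "w \<le> liminf ?r"
      unfolding s(1)
    proof (rule le_liminf_double_log)
      show "\<forall>\<^sub>F n in sequentially. 0 < t0 * (exp s ^ n - 1) \<and> P n \<le> exp (- (t0 * (exp s ^ n - 1)))"
        using eventually_gt_at_top[of 0]
      proof eventually_elim
        case (elim n)
        have "P n \<le> exp (- (t0 * ((exp a / c) ^ n - 1)))"
          unfolding P_def using c assms(5) t0 by (intro prob_brw_count_le_mgf) auto
        then show ?case
          using t0 s elim by (simp add: ratio one_less_power)
      qed
      show "(\<lambda>n. ln (t0 * (exp s ^ n - 1)) / real n) \<longlonglongrightarrow> s"
        using t0(1) s(2) by real_asymp
    qed
  qed

  have lower_if_eq: "ereal (a - ln m) \<le> liminf ?r" if "a = ln m"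
  proof -
    \<comment> \<open>The step has mean \<open>0 < x / 2\<close>, which leaves the decay \<open>exp (- (x / 2) * l * n)\<close>.\<close>
    obtain l where l: "0 < l" "(\<integral>\<^sup>+y. ennreal (exp (l * y)) \<partial>\<nu>) \<le> ennreal (exp (x / 2 * l))"
      using step.mgf_le_exp_near_zero[OF assms(6) \<kappa>, of "x / 2"] assms(7,12) by (auto simp: less_imp_le)
    have "ennreal m = (\<integral>\<^sup>+\<omega>. ennreal (real (N [] \<omega>)) \<partial>M)"
      using int_N mean_N by (simp add: nn_integral_eq_integral)
    then have mean: "(\<integral>\<^sup>+k. of_nat k \<partial>measure_pmf p) = ennreal m"
      using nn_integral_offspring[where f = "\<lambda>k. ennreal (real k)" and u = "[]"]
      by (simp add: ennreal_of_nat_eq_real_of_nat)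
    have "ereal 0 \<le> liminf ?r"
    proof (rule le_liminf_double_log)
      show "\<forall>\<^sub>F n in sequentially. 0 < x / 2 * l * real n \<and> P n \<le> exp (- (x / 2 * l * real n))"
        using eventually_gt_at_top[of 0]
      proof eventually_elim
        case (elim n)
        show ?case
          using prob_brw_count_le_many_to_one[OF mean _ assms(14) l, of n x] assms(5,12) l(1) elim
          by (simp add: P_def)
      qed
      show "(\<lambda>n. ln (x / 2 * l * real n) / real n) \<longlonglongrightarrow> 0"
        using l(1) assms(12) by real_asymp
    qed
    then show ?thesis
      using that by simp
  qed

  define \<alpha> where "\<alpha> = min_offspring_above p a"
  have \<alpha>: "0 < pmf p \<alpha>" "exp a \<le> real \<alpha>"
    unfolding \<alpha>_def using min_offspring_above_in_support assms(2,15) by auto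
  have "m \<le> exp a"
    using assms(5,14) by (simp flip: ln_le_cancel_iff)
  then have \<alpha>_gt_1: "1 < real \<alpha>"
    using assms(5) \<alpha>(2) by linarith
  define c where "c = pmf p \<alpha> * measure \<nu> {x..}"
  have c: "0 < c" "c \<le> 1"
    unfolding c_def
    using \<alpha>(1) measure_atLeast_pos_if_less_ess_sup[OF step.real_distribution_axioms assms(13)]
    by (auto simp: pmf_le_1 intro!: mult_le_one)
  have upper: "limsup ?r \<le> ereal (ln (real \<alpha>))"
  proof (rule limsup_double_log_le)
    \<comment> \<open>The summand \<open>1\<close> makes the factor \<open>1 - ln c\<close> positive even if \<open>c = 1\<close>; it does not change the rate.\<close>
    let ?b = "\<lambda>n. (1 - ln c) * ((real n + 1) * real \<alpha> ^ n)"
    show "\<forall>\<^sub>F n in sequentially. 0 < ?b n \<and> exp (- ?b n) \<le> P n"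
    proof (intro always_eventually allI conjI)
      fix n :: nat
      have pos: "0 < 1 - ln c"
        using c ln_le_zero_iff[of c] by linarith
      then show "0 < ?b n"
        using \<alpha>_gt_1 by (intro mult_pos_pos) auto
      have "real (\<Sum>i\<le>n. \<alpha> ^ i) \<le> (\<Sum>i\<le>n. real \<alpha> ^ n)"
        unfolding of_nat_sum of_nat_power using \<alpha>_gt_1 by (intro sum_mono power_increasing) auto
      then have K: "real (\<Sum>i\<le>n. \<alpha> ^ i) \<le> (real n + 1) * real \<alpha> ^ n"
        by (simp add: add.commute)
      have "real (\<Sum>i\<le>n. \<alpha> ^ i) * (- ln c) \<le> real (\<Sum>i\<le>n. \<alpha> ^ i) * (1 - ln c)"
        by (intro mult_left_mono) (auto intro: sum_nonneg)
      also have "\<dots> \<le> ?b n"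
        using mult_right_mono[OF K, of "1 - ln c"] pos by (simp add: mult.commute)
      finally have "exp (- ?b n) \<le> exp (real (\<Sum>i\<le>n. \<alpha> ^ i) * ln c)"
        by simp
      also have "\<dots> = c ^ (\<Sum>i\<le>n. \<alpha> ^ i)"
        unfolding exp_of_nat_mult using c by simp
      also have "\<dots> \<le> prob {\<omega> \<in> space M. real (brw_count N Y n {x * real n..} \<omega>) \<ge> real \<alpha> ^ n}"
        unfolding c_def by (rule prob_full_tree_ge)
      also have "\<dots> \<le> P n"
        unfolding P_def
      proof (rule finite_measure_mono)
        have "exp (a * real n) \<le> real \<alpha> ^ n"
          using power_mono[OF \<alpha>(2), of n] by (simp add: exp_of_nat2_mult)
        then show "{\<omega> \<in> space M. real (brw_count N Y n {x * real n..} \<omega>) \<ge> real \<alpha> ^ n}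
            \<subseteq> {\<omega> \<in> space M. real (brw_count N Y n {x * real n..} \<omega>) \<ge> exp (a * real n)}"
          by (blast intro: order_trans)
      qed measurable
      finally show "exp (- ?b n) \<le> P n" .
    qed
    have "0 < 1 - ln c"
      using c ln_le_zero_iff[of c] by linarith
    then show "(\<lambda>n. ln (?b n) / real n) \<longlonglongrightarrow> ln (real \<alpha>)"
      using \<alpha>_gt_1 by real_asymp
  qed

  have "ereal (a - ln m) \<le> liminf ?r"
    using lower_if_gt lower_if_eq assms(14) by linarith
  moreover have "liminf ?r \<le> limsup ?r"
    by (rule Liminf_le_Limsup) simp
  ultimately show ?thesis
    using upper by (simp add: Let_def P_def \<alpha>_def)
qed

end
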